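(* The vectors $$Y_{m_1}\cdots Y_{m_r}Y^{*}_{n_1}\cdots Y^{*}_{n_s}\cdot 1,$$ where $r,s\ge 0$, $m_1,\dots,m_r,n_1,\dots,n_s\in\mathbb{Z}$, satisfying $$m_1>m_2+1>\cdots >m_r+(r-1)\quad\text{and}\quad n_1>n_2+1>\cdots >n_s+(s-1),$$ form a basis of the algebra $\mathcal{A}$ over $\mathbb{C}$.
   Context: $\mathcal{A}$ denotes the associative algebra with identity over $\mathbb{C}$ with generators $Y_n, Y_n^{*}$ ($n\in\mathbb{Z}$), subject to the relations $$Y_mY_n+Y_{n+1}Y_{m-1}=0,\qquad Y_m^{*}Y_n^{*}+Y_{n+1}^{*}Y_{m-1}^{*}=0,\qquad Y_mY_n^{*}+Y_{n-1}^{*}Y_{m+1}=\delta_{m+n,0}$$ for $m,n\in\mathbb{Z}$. For $r=s=0$ the product is the identity $1$. The chain condition means $m_i+(i-1)>m_{i+1}+i$ for $1\le i<r$, and similarly for the $n_j$. *)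

theory Defs
  imports Complex_Main "HOL-Library.Poly_Mapping"
begin

text \<open>Lists under concatenation form the free monoid. Writing it additively makes
  \<open>'a list \<Rightarrow>\<^sub>0 complex\<close>, with the convolution product of finitely supported functions,
  the free associative unital algebra over the complex numbers on the set of generators \<open>'a\<close>.\<close>

instantiation list :: (type) monoid_add
begin

definition zero_list :: "'a list" where "zero_list = []"

definition plus_list :: "'a list \<Rightarrow> 'a list \<Rightarrow> 'a list" where "plus_list xs ys = xs @ ys"

instance by standard (simp_all add: zero_list_def plus_list_def)

end

datatype gen = Gen_Y int | Gen_Ystar int

type_synonym free_alg = "gen list \<Rightarrow>\<^sub>0 complex"

definition free_gen :: "gen \<Rightarrow> free_alg" where
  "free_gen g = Poly_Mapping.single [g] 1"

abbreviation fY :: "int \<Rightarrow> free_alg" where "fY n \<equiv> free_gen (Gen_Y n)"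

abbreviation fYstar :: "int \<Rightarrow> free_alg" where "fYstar n \<equiv> free_gen (Gen_Ystar n)"

definition relators :: "free_alg set" where
  "relators =
     {fY m * fY n + fY (n + 1) * fY (m - 1) | m n. True} \<union>
     {fYstar m * fYstar n + fYstar (n + 1) * fYstar (m - 1) | m n. True} \<union>
     {fY m * fYstar n + fYstar (n - 1) * fY (m + 1) - (if m + n = 0 then 1 else 0) | m n. True}"

text \<open>The two-sided ideal generated by the relators. It is closed under complex scalars,
  because scalars act as multiplication by constants of the free algebra.\<close>

inductive_set rel_ideal :: "free_alg set" where
  relator: "r \<in> relators \<Longrightarrow> r \<in> rel_ideal"
| zero: "0 \<in> rel_ideal"
| add: "x \<in> rel_ideal \<Longrightarrow> y \<in> rel_ideal \<Longrightarrow> x + y \<in> rel_ideal"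
| mult_left: "x \<in> rel_ideal \<Longrightarrow> a * x \<in> rel_ideal"
| mult_right: "x \<in> rel_ideal \<Longrightarrow> x * a \<in> rel_ideal"

lemma rel_ideal_uminus: "x \<in> rel_ideal \<Longrightarrow> - x \<in> rel_ideal"
  using rel_ideal.mult_left[of x "- 1"] by simp

lemma rel_ideal_diff: "x \<in> rel_ideal \<Longrightarrow> y \<in> rel_ideal \<Longrightarrow> x - y \<in> rel_ideal"
  using rel_ideal.add[of x "- y"] rel_ideal_uminus[of y] by simp

definition alg_rel :: "free_alg \<Rightarrow> free_alg \<Rightarrow> bool" where
  "alg_rel x y \<longleftrightarrow> x - y \<in> rel_ideal"

lemma equivp_alg_rel: "equivp alg_rel"
proof (rule equivpI)
  show "reflp alg_rel"
    by (simp add: reflp_def alg_rel_def rel_ideal.zero)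
  show "symp alg_rel"
    unfolding symp_def alg_rel_def using rel_ideal_uminus by fastforce
  show "transp alg_rel"
    unfolding transp_def alg_rel_def using rel_ideal.add by fastforce
qed

quotient_type alg = free_alg / alg_rel
  by (rule equivp_alg_rel)

text \<open>The class \<open>ring_1\<close> would also demand \<open>0 \<noteq> 1\<close>, which is not part of the definition of the
  algebra, hence the sort \<open>{ring, monoid_mult}\<close>.\<close>

instantiation alg :: "{ring, monoid_mult}"
begin

lift_definition zero_alg :: alg is "0 :: free_alg" .

lift_definition one_alg :: alg is "1 :: free_alg" .

lift_definition plus_alg :: "alg \<Rightarrow> alg \<Rightarrow> alg" is "(+) :: free_alg \<Rightarrow> _"
  unfolding alg_rel_def using rel_ideal.add by (metis add_diff_add)

lift_definition uminus_alg :: "alg \<Rightarrow> alg" is "uminus :: free_alg \<Rightarrow> _"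
  unfolding alg_rel_def using rel_ideal_uminus by fastforce

lift_definition minus_alg :: "alg \<Rightarrow> alg \<Rightarrow> alg" is "(-) :: free_alg \<Rightarrow> _"
proof -
  fix a b c d :: free_alg
  assume "alg_rel a b" "alg_rel c d"
  moreover have "a - c - (b - d) = (a - b) - (c - d)" by (simp add: algebra_simps)
  ultimately show "alg_rel (a - c) (b - d)"
    unfolding alg_rel_def using rel_ideal_diff by metis
qed

lift_definition times_alg :: "alg \<Rightarrow> alg \<Rightarrow> alg" is "(*) :: free_alg \<Rightarrow> _"
proof -
  fix a b c d :: free_alg
  assume "alg_rel a b" "alg_rel c d"
  moreover have "a * c - b * d = (a - b) * c + b * (c - d)" by (simp add: algebra_simps)
  ultimately show "alg_rel (a * c) (b * d)"
    unfolding alg_rel_def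
    by (metis rel_ideal.add rel_ideal.mult_left rel_ideal.mult_right)
qed

instance
proof
  fix a b c :: alg
  show "a + b + c = a + (b + c)" by transfer (simp add: algebra_simps alg_rel_def rel_ideal.zero)
  show "a + b = b + a" by transfer (simp add: algebra_simps alg_rel_def rel_ideal.zero)
  show "0 + a = a" by transfer (simp add: alg_rel_def rel_ideal.zero)
  show "- a + a = 0" by transfer (simp add: alg_rel_def rel_ideal.zero)
  show "a - b = a + - b" by transfer (simp add: alg_rel_def rel_ideal.zero)
  show "a * b * c = a * (b * c)" by transfer (simp add: mult.assoc alg_rel_def rel_ideal.zero)
  show "1 * a = a" by transfer (simp add: alg_rel_def rel_ideal.zero)
  show "a * 1 = a" by transfer (simp add: alg_rel_def rel_ideal.zero)
  show "(a + b) * c = a * c + b * c" by transfer (simp add: algebra_simps alg_rel_def rel_ideal.zero)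
  show "a * (b + c) = a * b + a * c" by transfer (simp add: algebra_simps alg_rel_def rel_ideal.zero)
qed

end

text \<open>\<open>Poly_Mapping.single 0 c\<close> is the constant \<open>c\<close>, since \<open>0\<close> is the empty word.\<close>

lift_definition scale_alg :: "complex \<Rightarrow> alg \<Rightarrow> alg" (infixr \<open>*\<^sub>A\<close> 75)
  is "\<lambda>c x. Poly_Mapping.single 0 c * x"
  unfolding alg_rel_def by (metis rel_ideal.mult_left right_diff_distrib)

interpretation alg: vector_space scale_alg
proof
  fix a b :: complex and x y :: alg
  show "a *\<^sub>A (x + y) = a *\<^sub>A x + a *\<^sub>A y"
    by transfer (simp add: algebra_simps alg_rel_def rel_ideal.zero)
  show "(a + b) *\<^sub>A x = a *\<^sub>A x + b *\<^sub>A x"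
    by transfer (simp add: single_add algebra_simps alg_rel_def rel_ideal.zero)
  show "a *\<^sub>A b *\<^sub>A x = (a * b) *\<^sub>A x"
    by transfer (simp add: mult_single mult.assoc[symmetric] alg_rel_def rel_ideal.zero)
  show "1 *\<^sub>A x = x"
    by transfer (simp add: alg_rel_def rel_ideal.zero)
qed

lemma single_zero_central:
  "Poly_Mapping.single 0 c * x = x * Poly_Mapping.single 0 (c :: complex)"
  for x :: "'a::monoid_add \<Rightarrow>\<^sub>0 complex"
proof (induction x rule: update_induct)
  case const
  show ?case by simp
next
  case (update f a b)
  have "Poly_Mapping.update a b f = f + Poly_Mapping.single a b"
    by (rule poly_mapping_eqI)
      (use update in \<open>auto simp: lookup_update lookup_add lookup_single in_keys_iff when_def\<close>)
  with update show ?case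
    by (simp add: algebra_simps mult_single)
qed

lemma scale_alg_mult_left: "(c *\<^sub>A x) * y = c *\<^sub>A (x * y)"
  by transfer (simp add: mult.assoc alg_rel_def rel_ideal.zero)

lemma scale_alg_mult_right: "x * (c *\<^sub>A y) = c *\<^sub>A (x * y)"
proof transfer
  fix x y :: free_alg and c :: complex
  have "x * (Poly_Mapping.single 0 c * y) = Poly_Mapping.single 0 c * (x * y)"
    by (metis mult.assoc single_zero_central)
  then show "alg_rel (x * (Poly_Mapping.single 0 c * y)) (Poly_Mapping.single 0 c * (x * y))"
    by (simp add: alg_rel_def rel_ideal.zero)
qed

lift_definition Y :: "int \<Rightarrow> alg" is fY .

lift_definition Ystar :: "int \<Rightarrow> alg" is fYstar .

lemma Y_Y: "Y m * Y n + Y (n + 1) * Y (m - 1) = 0"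
  by transfer (unfold alg_rel_def diff_0_right, rule rel_ideal.relator, unfold relators_def, blast)

lemma Ystar_Ystar: "Ystar m * Ystar n + Ystar (n + 1) * Ystar (m - 1) = 0"
  by transfer (unfold alg_rel_def diff_0_right, rule rel_ideal.relator, unfold relators_def, blast)

lemma Y_Ystar:
  "Y m * Ystar n + Ystar (n - 1) * Y (m + 1) = (if m + n = 0 then 1 else 0)"
  by transfer (unfold alg_rel_def, rule rel_ideal.relator, unfold relators_def, blast)

text \<open>With indices counted from \<open>0\<close>, the chain \<open>m\<^sub>1 > m\<^sub>2 + 1 > \<dots> > m\<^sub>r + (r - 1)\<close>.\<close>

definition chain_cond :: "int list \<Rightarrow> bool" where
  "chain_cond ms \<longleftrightarrow> (\<forall>i. Suc i < length ms \<longrightarrow> ms ! i + int i > ms ! Suc i + int (Suc i))"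

definition Y_monomial :: "int list \<times> int list \<Rightarrow> alg" where
  "Y_monomial = (\<lambda>(ms, ns). prod_list (map Y ms) * prod_list (map Ystar ns))"

end

theory Submission
  imports Defs
begin

text \<open>Moving each \<open>Y\<^sup>*\<close> to the right of the \<open>Y\<close>'s and then sorting both blocks shows that the
  monomials span. For independence, \<open>\<A>\<close> acts on the exterior algebra of a space with basis
  indexed by the integers: on elements of degree \<open>d\<close>, \<open>Y\<^sub>n\<close> is the wedge with the basis vector
  \<open>n - d\<close> and \<open>Y\<^sup>*\<^sub>n\<close> the contraction with the basis vector \<open>1 - n - d\<close>. A chain of \<open>s\<close> factors
  \<open>Y\<^sup>*\<close> kills every basis element of degree at most \<open>s\<close> but one, which it sends to a nonzero
  multiple of the vacuum; distinct chains of \<open>Y\<close>'s send the vacuum to nonzero multiples of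
  distinct basis elements. Hence the matrix coefficients are
  triangular with respect to \<open>s\<close>.\<close>

section \<open>Spanning\<close>

lemma chain_cond_Nil: "chain_cond []"
  by (simp add: chain_cond_def)

lemma chain_cond_Cons:
  "chain_cond (m # ms) \<longleftrightarrow> chain_cond ms \<and> (ms \<noteq> [] \<longrightarrow> m > hd ms + 1)"
proof
  assume *: "chain_cond (m # ms)"
  have "ms ! i + int i > ms ! Suc i + int (Suc i)" if "Suc i < length ms" for i
    using *[unfolded chain_cond_def, rule_format, of "Suc i"] that by simp
  moreover have "m > hd ms + 1" if "ms \<noteq> []"
    using *[unfolded chain_cond_def, rule_format, of 0] that by (simp add: hd_conv_nth)
  ultimately show "chain_cond ms \<and> (ms \<noteq> [] \<longrightarrow> m > hd ms + 1)"
    by (simp add: chain_cond_def)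
next
  assume *: "chain_cond ms \<and> (ms \<noteq> [] \<longrightarrow> m > hd ms + 1)"
  show "chain_cond (m # ms)"
    unfolding chain_cond_def
  proof (intro allI impI)
    fix i assume i: "Suc i < length (m # ms)"
    show "(m # ms) ! i + int i > (m # ms) ! Suc i + int (Suc i)"
    proof (cases i)
      case 0
      with * i show ?thesis by (auto simp: hd_conv_nth)
    next
      case (Suc k)
      with * i show ?thesis unfolding chain_cond_def by fastforce
    qed
  qed
qed

text \<open>In terms of the shifted indices \<open>m\<^sub>i + (i - 1)\<close> the quadratic relation is plain
  antisymmetry, so this is insertion into a strictly decreasing list.\<close>

lemma straighten_insert:
  fixes Z :: "int \<Rightarrow> alg"
  assumes Z: "\<And>m n. Z m * Z n + Z (n + 1) * Z (m - 1) = 0"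
  assumes "chain_cond ns"
  shows "\<exists>c ms. Z m * prod_list (map Z ns) = c *\<^sub>A prod_list (map Z ms) \<and> chain_cond ms \<and>
    (ms \<noteq> [] \<longrightarrow> hd ms = m \<or> ns \<noteq> [] \<and> hd ms = hd ns + 1)"
  using \<open>chain_cond ns\<close>
proof (induction ns arbitrary: m)
  case Nil
  show ?case
    by (rule exI[of _ 1], rule exI[of _ "[m]"]) (simp add: chain_cond_Cons chain_cond_Nil)
next
  case (Cons n ns)
  consider "m > n + 1" | "m = n + 1" | "m < n + 1" by linarith
  then show ?case
  proof cases
    case 1
    then show ?thesis
      using Cons.prems
      by (intro exI[of _ 1] exI[of _ "m # n # ns"]) (simp add: chain_cond_Cons)
  next
    case 2
    \<comment> \<open>For \<open>m = n + 1\<close> both terms of the relation are the same product,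
      which vanishes because 2 is invertible.\<close>
    have "(2::complex) *\<^sub>A (Z m * Z n) = Z m * Z n + Z m * Z n"
      using alg.scale_left_distrib[of 1 1 "Z m * Z n"] by simp
    also have "\<dots> = 0"
      using Z[of m n] 2 by simp
    finally have "Z m * Z n = 0"
      by simp
    then show ?thesis
      by (intro exI[of _ 0] exI[of _ "[]"]) (simp add: chain_cond_Nil flip: mult.assoc)
  next
    case 3
    from Cons.prems have ns: "chain_cond ns" "ns \<noteq> [] \<longrightarrow> n > hd ns + 1"
      by (auto simp: chain_cond_Cons)
    from Cons.IH[OF ns(1), of "m - 1"] obtain c ms where
      IH: "Z (m - 1) * prod_list (map Z ns) = c *\<^sub>A prod_list (map Z ms)" "chain_cond ms"
        "ms \<noteq> [] \<longrightarrow> hd ms = m - 1 \<or> ns \<noteq> [] \<and> hd ms = hd ns + 1"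
      by blast
    have "Z m * Z n = - (Z (n + 1) * Z (m - 1))"
      using Z[of m n] by (simp add: add_eq_0_iff)
    then have "Z m * prod_list (map Z (n # ns))
        = - (Z (n + 1) * (Z (m - 1) * prod_list (map Z ns)))"
      by (simp flip: mult.assoc)
    also have "\<dots> = (- c) *\<^sub>A prod_list (map Z ((n + 1) # ms))"
      by (simp add: IH(1) scale_alg_mult_right)
    \<comment> \<open>The clause on \<open>hd ms\<close> lets \<open>n + 1\<close> go in front:
      \<open>hd ms\<close> is \<open>m - 1\<close> or \<open>hd ns + 1\<close>, and both are below
      \<open>n\<close>.\<close>
    finally show ?thesis
      using IH(2,3) ns(2) 3
      by (intro exI[of _ "- c"] exI[of _ "(n + 1) # ms"]) (auto simp: chain_cond_Cons)
  qed
qed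

lemma straighten:
  fixes Z :: "int \<Rightarrow> alg"
  assumes Z: "\<And>m n. Z m * Z n + Z (n + 1) * Z (m - 1) = 0"
  shows "\<exists>c ms. prod_list (map Z ns) = c *\<^sub>A prod_list (map Z ms) \<and> chain_cond ms"
proof (induction ns)
  case Nil
  show ?case
    by (rule exI[of _ 1], rule exI[of _ "[]"]) (simp add: chain_cond_Nil)
next
  case (Cons n ns)
  then obtain c ms where "prod_list (map Z ns) = c *\<^sub>A prod_list (map Z ms)" "chain_cond ms"
    by blast
  moreover from straighten_insert[of Z, OF Z this(2), of n] obtain c' ms' where
    "Z n * prod_list (map Z ms) = c' *\<^sub>A prod_list (map Z ms')" "chain_cond ms'"
    by blast
  ultimately show ?case
    by (intro exI[of _ "c * c'"] exI[of _ ms']) (simp add: scale_alg_mult_right)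
qed

lemma Y_monomial_in_span_chain:
  "Y_monomial (ms, ns) \<in> alg.span (Y_monomial ` {(ms, ns). chain_cond ms \<and> chain_cond ns})"
proof -
  obtain c ms' where 1: "prod_list (map Y ms) = c *\<^sub>A prod_list (map Y ms')" "chain_cond ms'"
    using straighten[of Y, OF Y_Y] by blast
  obtain d ns' where
    2: "prod_list (map Ystar ns) = d *\<^sub>A prod_list (map Ystar ns')" "chain_cond ns'"
    using straighten[of Ystar, OF Ystar_Ystar] by blast
  have "Y_monomial (ms, ns) = (c * d) *\<^sub>A Y_monomial (ms', ns')"
    by (simp add: Y_monomial_def 1(1) 2(1) scale_alg_mult_left scale_alg_mult_right)
  with 1(2) 2(2) show ?thesis
    by (simp add: alg.span_scale alg.span_base)
qed

section \<open>Normal ordering: all \<open>Y\<close> to the left of all \<open>Ystar\<close>\<close>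

fun gen_alg :: "gen \<Rightarrow> alg" where
  "gen_alg (Gen_Y n) = Y n"
| "gen_alg (Gen_Ystar n) = Ystar n"

lemma gen_alg_eq_abs: "gen_alg g = abs_alg (Poly_Mapping.single [g] 1)"
  by (cases g) (simp_all add: Y_def Ystar_def free_gen_def)

lemma abs_alg_word: "abs_alg (Poly_Mapping.single w 1) = prod_list (map gen_alg w)"
proof (induction w)
  case Nil
  have "(Poly_Mapping.single [] 1 :: free_alg) = 1"
    using single_one by (metis zero_list_def)
  then show ?case
    by (simp add: one_alg_def)
next
  case (Cons g w)
  have "(Poly_Mapping.single (g # w) 1 :: free_alg)
      = Poly_Mapping.single [g] 1 * Poly_Mapping.single w 1"
    by (simp add: mult_single plus_list_def)
  with Cons show ?case
    by (simp add: times_alg.abs_eq[symmetric] gen_alg_eq_abs)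
qed

lemma poly_mapping_single_induct [case_names zero add_single]:
  fixes x :: "'a \<Rightarrow>\<^sub>0 'b::comm_monoid_add"
  assumes "P 0" and "\<And>x w c. P x \<Longrightarrow> P (x + Poly_Mapping.single w c)"
  shows "P x"
proof (induction x rule: update_induct)
  case const
  show ?case by fact
next
  case (update f a b)
  have "Poly_Mapping.update a b f = f + Poly_Mapping.single a b"
    by (rule poly_mapping_eqI)
      (use update in \<open>auto simp: lookup_update lookup_add lookup_single in_keys_iff when_def\<close>)
  with update assms(2) show ?case
    by simp
qed

text \<open>Words span the quotient and grow from 1 by left multiplication with generators.\<close>

lemma subspace_closed_under_gens:
  assumes P: "alg.subspace P" and one: "1 \<in> P"
    and closed: "\<And>g x. x \<in> P \<Longrightarrow> gen_alg g * x \<in> P"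
  shows "P = UNIV"
proof -
  have word: "prod_list (map gen_alg w) \<in> P" for w
    by (induction w) (auto simp: one closed)
  have "abs_alg f \<in> P" for f
  proof (induction f rule: poly_mapping_single_induct)
    case zero
    show ?case
      using alg.subspace_0[OF P] by (simp add: zero_alg_def)
  next
    case (add_single f w c)
    have "(Poly_Mapping.single w c :: free_alg)
        = Poly_Mapping.single 0 c * Poly_Mapping.single w 1"
      by (simp add: mult_single)
    then have "abs_alg (Poly_Mapping.single w c) = c *\<^sub>A prod_list (map gen_alg w)"
      by (simp add: scale_alg.abs_eq[symmetric] abs_alg_word)
    with add_single show ?case
      by (simp add: plus_alg.abs_eq[symmetric] alg.subspace_add[OF P] alg.subspace_scale[OF P] word)
  qed
  then show ?thesis
    using Quotient_abs_rep[OF Quotient_alg] by (metis UNIV_eq_I)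
qed

text \<open>A \<open>Y\<close> just lengthens its block. A \<open>Ystar\<close> moves right past one
  \<open>Y\<close> at a time: one term loses that \<open>Y\<close>, the other shifts both indices,
  so the induction needs every \<open>n\<close>.\<close>

lemma gen_Y_monomial_in_span: "gen_alg g * Y_monomial (ms, ns) \<in> alg.span (range Y_monomial)"
proof (cases g)
  case (Gen_Y m)
  then have "gen_alg g * Y_monomial (ms, ns) = Y_monomial (m # ms, ns)"
    by (simp add: Y_monomial_def mult.assoc)
  then show ?thesis
    by (simp add: alg.span_base)
next
  case (Gen_Ystar n)
  have "Ystar n * Y_monomial (ms, ns) \<in> alg.span (range Y_monomial)"
  proof (induction ms arbitrary: n)
    case Nil
    have "Ystar n * Y_monomial ([], ns) = Y_monomial ([], n # ns)"
      by (simp add: Y_monomial_def)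
    then show ?case
      by (simp add: alg.span_base)
  next
    case (Cons m ms)
    have Y_closed: "Y k * x \<in> alg.span (range Y_monomial)"
      if "x \<in> alg.span (range Y_monomial)" for k x
      using that
    proof (induction rule: alg.span_induct_alt)
      case base
      show ?case by (simp add: alg.span_zero)
    next
      case (step c x y)
      obtain ms' ns' where "x = Y_monomial (ms', ns')"
        using step by auto
      then have "Y k * x = Y_monomial (k # ms', ns')"
        by (simp add: Y_monomial_def mult.assoc)
      then show ?case
        using step
        by (simp add: distrib_left scale_alg_mult_right alg.span_add alg.span_scale alg.span_base)
    qed
    \<comment> \<open>At \<open>m - 1\<close> and \<open>n + 1\<close> the second term of
      \<open>Y_Ystar\<close> is the product to be rewritten.\<close>
    have "Ystar n * Y m
        = (if m + n = 0 then 1 else 0) - Y (m - 1) * Ystar (n + 1)"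
      using Y_Ystar[of "m - 1" "n + 1"] by (simp add: algebra_simps)
    then have "Ystar n * Y_monomial (m # ms, ns)
        = ((if m + n = 0 then 1 else 0) - Y (m - 1) * Ystar (n + 1)) * Y_monomial (ms, ns)"
      by (simp add: Y_monomial_def flip: mult.assoc)
    also have "\<dots> = (if m + n = 0 then Y_monomial (ms, ns) else 0)
        - Y (m - 1) * (Ystar (n + 1) * Y_monomial (ms, ns))"
      by (simp add: left_diff_distrib mult.assoc)
    finally show ?case
      using Cons.IH[of "n + 1"]
      by (auto intro!: alg.span_diff alg.span_neg Y_closed simp: alg.span_base alg.span_zero)
  qed
  with Gen_Ystar show ?thesis
    by simp
qed

lemma span_Y_monomial: "alg.span (range Y_monomial) = UNIV"
proof (rule subspace_closed_under_gens)
  have "Y_monomial ([], []) = 1"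
    by (simp add: Y_monomial_def)
  then show "1 \<in> alg.span (range Y_monomial)"
    by (metis alg.span_base rangeI)
  fix g x
  assume "x \<in> alg.span (range Y_monomial)"
  then show "gen_alg g * x \<in> alg.span (range Y_monomial)"
  proof (induction rule: alg.span_induct_alt)
    case base
    show ?case by (simp add: alg.span_zero)
  next
    case (step c x y)
    obtain ms ns where "x = Y_monomial (ms, ns)"
      using step by auto
    then show ?case
      using step gen_Y_monomial_in_span[of g ms ns]
      by (simp add: distrib_left scale_alg_mult_right alg.span_add alg.span_scale)
  qed
qed simp

lemma span_chain_monomials:
  "alg.span (Y_monomial ` {(ms, ns). chain_cond ms \<and> chain_cond ns}) = UNIV"
proof -
  have "range Y_monomial \<subseteq> alg.span (Y_monomial ` {(ms, ns). chain_cond ms \<and> chain_cond ns})"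
    using Y_monomial_in_span_chain by auto
  then show ?thesis
    using alg.span_minimal[OF _ alg.subspace_span] span_Y_monomial by blast
qed

section \<open>The exterior algebra representation\<close>

text \<open>A function on sets is a family of coefficients over basis wedges written with decreasing
  indices. The sign moves a factor \<open>a\<close> from the front past all larger indices. Each
  operator below reads a single coefficient of \<open>f\<close>, so infinite support does no
  harm.\<close>

definition insert_sign :: "int \<Rightarrow> int set \<Rightarrow> complex" where
  "insert_sign a S = (- 1) ^ card {x \<in> S. a < x}"

definition wedge :: "int \<Rightarrow> (int set \<Rightarrow> complex) \<Rightarrow> int set \<Rightarrow> complex" where
  "wedge a f S = (if a \<in> S then insert_sign a S * f (S - {a}) else 0)"

definition contract :: "int \<Rightarrow> (int set \<Rightarrow> complex) \<Rightarrow> int set \<Rightarrow> complex" where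
  "contract a f S = (if a \<in> S then 0 else insert_sign a S * f (insert a S))"

lemma insert_sign_insert:
  assumes "finite S" "b \<notin> S"
  shows "insert_sign a (insert b S) = (if a < b then - insert_sign a S else insert_sign a S)"
proof -
  have "{x \<in> insert b S. a < x} = (if a < b then insert b {x \<in> S. a < x} else {x \<in> S. a < x})"
    by auto
  with assms show ?thesis
    by (simp add: insert_sign_def)
qed

lemma insert_sign_remove:
  assumes "finite S" "b \<in> S"
  shows "insert_sign a (S - {b}) = (if a < b then - insert_sign a S else insert_sign a S)"
  using insert_sign_insert[of "S - {b}" b a] assms by (simp add: insert_absorb split: if_splits)

lemma insert_sign_square: "insert_sign a S * insert_sign a S = 1"
  by (simp add: insert_sign_def flip: power_add)

lemma wedge_wedge:
  assumes "finite S"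
  shows "wedge a (wedge b f) S + wedge b (wedge a f) S = 0"
proof -
  have "S - {a} - {b} = S - {b} - {a}" by auto
  then show ?thesis
    using assms by (auto simp: wedge_def insert_sign_remove)
qed

lemma contract_contract:
  assumes "finite S"
  shows "contract a (contract b f) S + contract b (contract a f) S = 0"
  using assms by (auto simp: contract_def insert_sign_insert insert_commute)

lemma wedge_contract:
  assumes "finite S"
  shows "wedge a (contract b f) S + contract b (wedge a f) S = (if a = b then f S else 0)"
proof (cases "a = b")
  case True
  then show ?thesis
    using assms
    by (auto simp: wedge_def contract_def insert_sign_insert insert_sign_remove insert_absorb
        insert_sign_square simp flip: mult.assoc)
next
  case False
  then have "insert b (S - {a}) = insert b S - {a}" by auto
  then show ?thesis
    using assms False
    by (auto simp: wedge_def contract_def insert_sign_insert insert_sign_remove)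
qed

text \<open>Up to an index shift depending on the exterior degree, \<open>Y\<^sub>n\<close> is a wedge operator and \<open>Y\<^sup>*\<^sub>n\<close> a
  contraction; the shifts are what turns the anticommutation relations into those of \<open>\<A>\<close>.
  All operators are given by their values at a basis element \<open>S\<close>, so \<open>card S\<close> is the degree
  after the operator is applied. On infinite sets \<open>card\<close> is junk and the relations fail, so
  only finite \<open>S\<close> count.\<close>

fun gen_op :: "gen \<Rightarrow> (int set \<Rightarrow> complex) \<Rightarrow> int set \<Rightarrow> complex" where
  "gen_op (Gen_Y n) f S = wedge (n - int (card S) + 1) f S"
| "gen_op (Gen_Ystar n) f S = contract (- n - int (card S)) f S"

text \<open>The inner operator is evaluated at a set whose size differs by one, which moves its
  index by one. In this and the next three lemmas the exchange of indices in the relations thereby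
  becomes a plain swap of the two operators.\<close>

lemma gen_op_Y_Y:
  assumes "finite S"
  shows "gen_op (Gen_Y m) (gen_op (Gen_Y n) f) S
    = wedge (m - int (card S) + 1) (wedge (n + 1 - int (card S) + 1) f) S"
  using assms card_Suc_Diff1[OF assms, of "m - int (card S) + 1"]
  by (auto simp: wedge_def card_Diff_singleton algebra_simps of_nat_diff)

lemma gen_op_Ystar_Ystar:
  assumes "finite S"
  shows "gen_op (Gen_Ystar m) (gen_op (Gen_Ystar n) f) S
    = contract (- m - int (card S)) (contract (- n - 1 - int (card S)) f) S"
  using assms by (auto simp: contract_def algebra_simps)

lemma gen_op_Y_Ystar:
  assumes "finite S"
  shows "gen_op (Gen_Y m) (gen_op (Gen_Ystar n) f) S
    = wedge (m + 1 - int (card S)) (contract (1 - n - int (card S)) f) S"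
  using assms card_Suc_Diff1[OF assms, of "m + 1 - int (card S)"]
  by (auto simp: wedge_def card_Diff_singleton algebra_simps of_nat_diff)

lemma gen_op_Ystar_Y:
  assumes "finite S"
  shows "gen_op (Gen_Ystar n) (gen_op (Gen_Y m) f) S
    = contract (- n - int (card S)) (wedge (m - int (card S)) f) S"
  using assms by (auto simp: contract_def algebra_simps)

section \<open>Action of the free algebra and descent to the quotient\<close>

definition word_op :: "gen list \<Rightarrow> (int set \<Rightarrow> complex) \<Rightarrow> int set \<Rightarrow> complex" where
  "word_op w f = foldr gen_op w f"

lemma word_op_simps [simp]:
  "word_op [] f = f"
  "word_op (g # w) f = gen_op g (word_op w f)"
  "word_op (v @ w) f = word_op v (word_op w f)"
  by (simp_all add: word_op_def)

definition free_op :: "free_alg \<Rightarrow> (int set \<Rightarrow> complex) \<Rightarrow> int set \<Rightarrow> complex" where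
  "free_op x f S = (\<Sum>w\<in>Poly_Mapping.keys x. Poly_Mapping.lookup x w * word_op w f S)"

lemma free_op_superset:
  assumes "finite W" "Poly_Mapping.keys x \<subseteq> W"
  shows "free_op x f S = (\<Sum>w\<in>W. Poly_Mapping.lookup x w * word_op w f S)"
  unfolding free_op_def
  by (rule sum.mono_neutral_left) (use assms in \<open>auto simp: in_keys_iff\<close>)

lemma free_op_0 [simp]: "free_op 0 f S = 0"
  by (simp add: free_op_def)

lemma free_op_single [simp]: "free_op (Poly_Mapping.single w c) f S = c * word_op w f S"
  by (simp add: free_op_def)

lemma free_op_add [simp]: "free_op (x + y) f S = free_op x f S + free_op y f S"
proof -
  let ?W = "Poly_Mapping.keys x \<union> Poly_Mapping.keys y"
  have "free_op (x + y) f S = (\<Sum>w\<in>?W. Poly_Mapping.lookup (x + y) w * word_op w f S)"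
    by (rule free_op_superset) (use Poly_Mapping.keys_add[of x y] in auto)
  also have "\<dots> = (\<Sum>w\<in>?W. Poly_Mapping.lookup x w * word_op w f S)
      + (\<Sum>w\<in>?W. Poly_Mapping.lookup y w * word_op w f S)"
    by (simp add: lookup_add algebra_simps sum.distrib)
  also have "\<dots> = free_op x f S + free_op y f S"
    by (simp add: free_op_superset[of ?W])
  finally show ?thesis .
qed

lemma free_op_diff [simp]: "free_op (x - y) f S = free_op x f S - free_op y f S"
  using free_op_add[of "x - y" y f S] by (simp add: algebra_simps)

lemma gen_op_linear:
  "gen_op g (\<lambda>S. a * f S + b * h S) S = a * gen_op g f S + b * gen_op g h S"
  by (cases g) (simp_all add: wedge_def contract_def algebra_simps)

lemma word_op_linear:
  "word_op w (\<lambda>S. a * f S + b * h S) = (\<lambda>S. a * word_op w f S + b * word_op w h S)"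
  by (induction w) (simp, rule ext, simp add: gen_op_linear)

lemma word_op_zero: "word_op w (\<lambda>S. 0) S = 0"
  using fun_cong[OF word_op_linear[of w 0 "\<lambda>S. 0" 0 "\<lambda>S. 0"]] by simp

lemma free_op_mult [simp]: "free_op (x * y) f S = free_op x (free_op y f) S"
proof (induction x rule: poly_mapping_single_induct)
  case zero
  show ?case by simp
next
  case (add_single x v c)
  have "free_op (Poly_Mapping.single v c * y) f S = c * word_op v (free_op y f) S"
  proof (induction y rule: poly_mapping_single_induct)
    case zero
    have "free_op 0 f = (\<lambda>S. 0)" by (simp add: fun_eq_iff)
    then show ?case by (simp add: word_op_zero)
  next
    case (add_single y w d)
    have "free_op (y + Poly_Mapping.single w d) f
        = (\<lambda>S. 1 * free_op y f S + d * word_op w f S)"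
      by (simp add: fun_eq_iff)
    then have *: "word_op v (free_op (y + Poly_Mapping.single w d) f)
        = (\<lambda>S. 1 * word_op v (free_op y f) S + d * word_op v (word_op w f) S)"
      by (simp only: word_op_linear)
    have "free_op (Poly_Mapping.single v c * (y + Poly_Mapping.single w d)) f S
        = c * (1 * word_op v (free_op y f) S + d * word_op v (word_op w f) S)"
      using add_single by (simp add: distrib_left mult_single plus_list_def)
    then show ?case
      by (simp only: *)
  qed
  with add_single show ?case
    by (simp add: distrib_right)
qed

text \<open>Adding or removing one element keeps a set finite. This carries vanishing at finite sets
  through left multiplication in the ideal.\<close>

lemma word_op_cong_finite:
  assumes "\<And>S. finite S \<Longrightarrow> f S = h S" "finite S"
  shows "word_op w f S = word_op w h S"
  using assms(2)
proof (induction w arbitrary: S)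
  case Nil
  then show ?case by (simp add: assms(1))
next
  case (Cons g w)
  then show ?case by (cases g) (simp_all add: wedge_def contract_def)
qed

lemma free_op_relator:
  assumes "r \<in> relators" "finite S"
  shows "free_op r f S = 0"
proof -
  have "(1 :: free_alg) = Poly_Mapping.single [] 1"
    by (metis single_one zero_list_def)
  then have one: "free_op 1 f S = f S"
    by (metis free_op_single word_op_simps(1) mult_1)
  have gen: "free_op (free_gen g) = gen_op g" for g
    by (simp add: fun_eq_iff free_gen_def)
  from assms(1) consider
    (YY) m n where "r = fY m * fY n + fY (n + 1) * fY (m - 1)"
    | (SS) m n where "r = fYstar m * fYstar n + fYstar (n + 1) * fYstar (m - 1)"
    | (YS) m n where "r = fY m * fYstar n + fYstar (n - 1) * fY (m + 1)
        - (if m + n = 0 then 1 else 0)"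
    unfolding relators_def by blast
  then show ?thesis
  proof cases
    case YY
    then show ?thesis
      using wedge_wedge[OF assms(2), of "m - int (card S) + 1" "n + 1 - int (card S) + 1" f]
      by (simp add: gen gen_op_Y_Y[OF assms(2)] del: gen_op.simps)
  next
    case SS
    then show ?thesis
      using contract_contract[OF assms(2), of "- m - int (card S)" "- n - 1 - int (card S)" f]
      by (simp add: gen gen_op_Ystar_Ystar[OF assms(2)] del: gen_op.simps)
  next
    \<comment> \<open>The wedge and contraction indices coincide exactly when
      \<open>m + n = 0\<close>, which yields the delta.\<close>
    case YS
    then show ?thesis
      using wedge_contract[OF assms(2), of "m + 1 - int (card S)" "1 - n - int (card S)" f]
      by (simp add: gen one eq_neg_iff_add_eq_0 gen_op_Y_Ystar[OF assms(2)] gen_op_Ystar_Y[OF assms(2)]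
          del: gen_op.simps)
  qed
qed

lemma free_op_rel_ideal:
  assumes "x \<in> rel_ideal" "finite S"
  shows "free_op x f S = 0"
  using assms
proof (induction x arbitrary: f S rule: rel_ideal.induct)
  case (relator r)
  then show ?case by (simp add: free_op_relator)
next
  case (mult_left x a)
  have "word_op w (free_op x f) S = 0" for w
    using word_op_cong_finite[of "free_op x f" "\<lambda>S. 0" S w] mult_left by (simp add: word_op_zero)
  then show ?case
    by (simp add: free_op_def[of a])
qed simp_all

text \<open>The coefficient at \<open>S\<close> of the image of basis element \<open>T\<close>. The
  value 0 at infinite \<open>S\<close> makes it well defined on the quotient.\<close>

lift_definition matrix_coeff :: "int set \<Rightarrow> int set \<Rightarrow> alg \<Rightarrow> complex"
  is "\<lambda>S T x. if finite S then free_op x (\<lambda>U. if U = T then 1 else 0) S else 0"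
  unfolding alg_rel_def using free_op_rel_ideal by (metis eq_iff_diff_eq_0 free_op_diff)

lemma matrix_coeff_add: "matrix_coeff S T (x + y) = matrix_coeff S T x + matrix_coeff S T y"
  by transfer simp

lemma matrix_coeff_scale: "matrix_coeff S T (c *\<^sub>A x) = c * matrix_coeff S T x"
  by transfer (simp add: zero_list_def)

lemma matrix_coeff_Y_monomial:
  assumes "finite S"
  shows "matrix_coeff S T (Y_monomial (ms, ns))
    = word_op (map Gen_Y ms) (word_op (map Gen_Ystar ns) (\<lambda>U. if U = T then 1 else 0)) S"
proof -
  have "Y_monomial (ms, ns) = abs_alg (Poly_Mapping.single (map Gen_Y ms @ map Gen_Ystar ns) 1)"
    by (simp add: Y_monomial_def abs_alg_word comp_def)
  with assms show ?thesis
    by (simp add: matrix_coeff.abs_eq)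
qed

section \<open>Linear independence\<close>

text \<open>For \<open>k = card U\<close>, the negatives are the indices that a word in the
  \<open>Ystar\<close> evaluated at \<open>U\<close> inserts in turn. Under the chain condition the
  listed numbers strictly decrease.\<close>

fun shifted_set :: "int \<Rightarrow> int list \<Rightarrow> int set" where
  "shifted_set k [] = {}"
| "shifted_set k (n # ns) = insert (n + k) (shifted_set (k + 1) ns)"

lemma finite_shifted_set [simp]: "finite (shifted_set k ns)"
  by (induction ns arbitrary: k) auto

lemma shifted_set_less:
  assumes "chain_cond (n # ns)" "x \<in> shifted_set (k + 1) ns"
  shows "x < n + k"
  using assms
proof (induction ns arbitrary: n k)
  case Nil
  then show ?case by simp
next
  case (Cons n' ns)
  then have "x = n' + (k + 1) \<or> x < n' + (k + 1)"
    by (auto simp: chain_cond_Cons)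
  with Cons.prems(1) show ?case
    by (auto simp: chain_cond_Cons)
qed

lemma card_shifted_set: "chain_cond ns \<Longrightarrow> card (shifted_set k ns) = length ns"
proof (induction ns arbitrary: k)
  case (Cons n ns)
  then have "n + k \<notin> shifted_set (k + 1) ns"
    using shifted_set_less by blast
  with Cons show ?case
    by (simp add: chain_cond_Cons)
qed simp

lemma shifted_set_inj:
  assumes "chain_cond ms" "chain_cond ns" "shifted_set k ms = shifted_set k ns"
  shows "ms = ns"
  using assms
proof (induction ms arbitrary: k ns)
  case Nil
  then show ?case by (cases ns) auto
next
  case (Cons m ms)
  then obtain n ns' where ns: "ns = n # ns'"
    by (cases ns) auto
  have less: "x < m + k" if "x \<in> shifted_set (k + 1) ms" for x
    using shifted_set_less Cons.prems(1) that .
  have less': "x < n + k" if "x \<in> shifted_set (k + 1) ns'" for x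
    using shifted_set_less Cons.prems(2)[unfolded ns] that .
  have eq: "insert (m + k) (shifted_set (k + 1) ms) = insert (n + k) (shifted_set (k + 1) ns')"
    using Cons.prems(3) ns by simp
  \<comment> \<open>Otherwise \<open>m + k\<close> and \<open>n + k\<close> would each lie in the
    tail set of the other list, hence each be smaller than the other.\<close>
  have "m = n"
    using eq less[of "n + k"] less'[of "m + k"] by (metis add_right_cancel insertE insertI1 less_asym)
  moreover from this have "shifted_set (k + 1) ms = shifted_set (k + 1) ns'"
    using eq less[of "m + k"] less'[of "n + k"] by (metis insert_ident less_irrefl)
  ultimately show ?case
    using Cons.IH[of ns' "k + 1"] Cons.prems(1,2) ns by (simp add: chain_cond_Cons)
qed

text \<open>A contraction reads its coefficient from a set with one new element, so from
  \<open>U\<close> there is a single path of insertions, and it must end at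
  \<open>T\<close>.\<close>

lemma Ystar_word_support:
  assumes "finite U" "word_op (map Gen_Ystar ns) (\<lambda>U. if U = T then 1 else 0) U \<noteq> 0"
  shows "T = U \<union> uminus ` shifted_set (int (card U)) ns \<and> card T = card U + length ns"
  using assms
proof (induction ns arbitrary: U)
  case Nil
  then show ?case by (auto split: if_splits)
next
  case (Cons n ns)
  define a where "a = - n - int (card U)"
  from Cons.prems have "a \<notin> U"
    and "word_op (map Gen_Ystar ns) (\<lambda>U. if U = T then 1 else 0) (insert a U) \<noteq> 0"
    by (auto simp: contract_def a_def split: if_splits)
  with Cons.IH[of "insert a U"] Cons.prems(1) show ?case
    by (auto simp: a_def add.commute)
qed

lemma Ystar_word_nonzero:
  assumes "finite U" "chain_cond ns" "U \<inter> uminus ` shifted_set (int (card U)) ns = {}"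
    and "T = U \<union> uminus ` shifted_set (int (card U)) ns"
  shows "word_op (map Gen_Ystar ns) (\<lambda>U. if U = T then 1 else 0) U \<noteq> 0"
  using assms
proof (induction ns arbitrary: U)
  case Nil
  then show ?case by simp
next
  case (Cons n ns)
  define k where "k = int (card U)"
  define a where "a = - n - k"
  have a: "a \<notin> U"
    using Cons.prems(3) by (auto simp: a_def k_def)
  then have card: "int (card (insert a U)) = k + 1"
    using Cons.prems(1) by (simp add: k_def)
  \<comment> \<open>The head gives the maximum \<open>n + k\<close>, so its negative
    \<open>a\<close> lies below everything inserted later.\<close>
  have "a \<notin> uminus ` shifted_set (k + 1) ns"
    using shifted_set_less[OF Cons.prems(2), of _ k] by (force simp: a_def)
  then have "insert a U \<inter> uminus ` shifted_set (k + 1) ns = {}"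
    using Cons.prems(3) by (auto simp: k_def)
  moreover have "T = insert a U \<union> uminus ` shifted_set (k + 1) ns"
    using Cons.prems(4) by (auto simp: k_def a_def)
  ultimately have "word_op (map Gen_Ystar ns) (\<lambda>U. if U = T then 1 else 0) (insert a U) \<noteq> 0"
    using Cons.IH[of "insert a U"] Cons.prems(1,2) card by (simp add: chain_cond_Cons)
  with a show ?case
    by (simp add: contract_def insert_sign_def a_def k_def)
qed

text \<open>The set at which a word in the \<open>Y\<close>'s has a nonzero vacuum coefficient, each index being
  lowered by the number of factors to its right.\<close>

fun Y_set :: "int list \<Rightarrow> int set" where
  "Y_set [] = {}"
| "Y_set (m # ms) = insert (m - int (length ms)) (Y_set ms)"

text \<open>For a fixed length the two sets are translates of each other, so size and injectivity
  carry over.\<close>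

lemma Y_set_eq_shifted: "Y_set ms = (\<lambda>x. x - k - int (length ms) + 1) ` shifted_set k ms"
proof (induction ms arbitrary: k)
  case (Cons m ms)
  show ?case
    using Cons.IH[of "k + 1"] by (simp add: algebra_simps)
qed simp

lemma card_Y_set:
  assumes "chain_cond ms"
  shows "card (Y_set ms) = length ms"
  using assms card_shifted_set[of ms 0]
  by (simp add: Y_set_eq_shifted[of ms 0] card_image inj_on_def)

lemma finite_Y_set [simp]: "finite (Y_set ms)"
  by (simp add: Y_set_eq_shifted[of ms 0])

text \<open>On finite sets \<open>h\<close> is a multiple of the vacuum. Each wedge reads from a set
  with one element fewer, so the word descends from \<open>S\<close> to the empty set. The size of
  \<open>S\<close> is tracked because the wedge indices depend on it.\<close>

lemma Y_word_support:
  assumes "finite S" "\<And>U. finite U \<Longrightarrow> h U \<noteq> 0 \<Longrightarrow> U = {}" "word_op (map Gen_Y ms) h S \<noteq> 0"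
  shows "S = Y_set ms \<and> card S = length ms"
  using assms(1,3)
proof (induction ms arbitrary: S)
  case Nil
  then show ?case using assms(2) by auto
next
  case (Cons m ms)
  define a where "a = m - int (card S) + 1"
  from Cons.prems have a: "a \<in> S" "word_op (map Gen_Y ms) h (S - {a}) \<noteq> 0"
    by (auto simp: wedge_def a_def split: if_splits)
  have IH: "S - {a} = Y_set ms" "card (S - {a}) = length ms"
    using Cons.IH[OF _ a(2)] Cons.prems(1) by blast+
  have card: "card S = Suc (length ms)"
    using IH(2) a(1) Cons.prems(1) card_Suc_Diff1 by metis
  then have "a = m - int (length ms)"
    by (simp add: a_def)
  moreover have "S = insert a (Y_set ms)"
    using IH(1) a(1) by blast
  ultimately show ?case
    using card by simp
qed

lemma Y_word_nonzero:
  assumes "chain_cond ms" "h {} \<noteq> 0"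
  shows "word_op (map Gen_Y ms) h (Y_set ms) \<noteq> 0"
  using assms(1)
proof (induction ms)
  case Nil
  then show ?case by (simp add: assms(2))
next
  case (Cons m ms)
  \<comment> \<open>The outermost wedge index exceeds all others. Offset 1 for the tail matches
    \<open>shifted_set_less\<close> at offset 0.\<close>
  have *: "x < m - int (length ms)" if "x \<in> Y_set ms" for x
    using that shifted_set_less[OF Cons.prems, of _ 0]
    by (force simp: Y_set_eq_shifted[of ms 1])
  have "m - int (length ms) \<notin> Y_set ms"
    using * by blast
  with Cons show ?case
    by (simp add: wedge_def insert_sign_def chain_cond_Cons card_Y_set)
qed

lemma Y_set_inj:
  assumes "chain_cond ms" "chain_cond ns" "Y_set ms = Y_set ns" "length ms = length ns"
  shows "ms = ns"
proof -
  have "inj (\<lambda>x::int. x - 0 - int (length ns) + 1)"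
    by (simp add: inj_def)
  with assms have "shifted_set 0 ms = shifted_set 0 ns"
    by (simp add: Y_set_eq_shifted[of _ 0] inj_image_eq_iff)
  with assms show ?thesis
    using shifted_set_inj by blast
qed

lemma matrix_coeff_self:
  assumes "chain_cond ms" "chain_cond ns"
  shows "matrix_coeff (Y_set ms) (uminus ` shifted_set 0 ns) (Y_monomial (ms, ns)) \<noteq> 0"
  using assms by (simp add: matrix_coeff_Y_monomial Y_word_nonzero Ystar_word_nonzero)

text \<open>A nonzero coefficient of the \<open>Ystar\<close> block at \<open>U\<close> forces
  \<open>card T = card U + length ns'\<close>. Since \<open>card T = length ns\<close>, the length
  bound leaves only the vacuum, and injectivity identifies both chains.\<close>

lemma matrix_coeff_other:
  assumes "chain_cond ms" "chain_cond ns" "chain_cond ms'" "chain_cond ns'"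
    and "length ns \<le> length ns'"
    and "matrix_coeff (Y_set ms) (uminus ` shifted_set 0 ns) (Y_monomial (ms', ns')) \<noteq> 0"
  shows "ms' = ms \<and> ns' = ns"
proof -
  define T where "T = uminus ` shifted_set 0 ns"
  define h :: "int set \<Rightarrow> complex"
    where "h = word_op (map Gen_Ystar ns') (\<lambda>U. if U = T then 1 else 0)"
  have card_T: "card T = length ns"
    using assms(2) by (simp add: T_def card_image card_shifted_set)
  have h: "U = {} \<and> ns' = ns" if "finite U" "h U \<noteq> 0" for U
  proof -
    from Ystar_word_support[OF that[unfolded h_def]] card_T assms(5) that(1)
    have "U = {}" "T = uminus ` shifted_set 0 ns'"
      by auto
    then show ?thesis
      using assms(2,4) shifted_set_inj by (auto simp: T_def inj_image_eq_iff)
  qed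
  have nz: "word_op (map Gen_Y ms') h (Y_set ms) \<noteq> 0"
    using assms(6) by (simp add: matrix_coeff_Y_monomial h_def T_def)
  then have "Y_set ms = Y_set ms' \<and> card (Y_set ms) = length ms'"
    using Y_word_support[of "Y_set ms" h ms'] h by auto
  then have "ms' = ms"
    using Y_set_inj assms(1,3) card_Y_set by metis
  \<comment> \<open>If \<open>h\<close> vanished at all finite sets, so would the whole coefficient;
    a witness is what gives \<open>ns' = ns\<close>.\<close>
  moreover have "\<exists>U. finite U \<and> h U \<noteq> 0"
    using nz word_op_cong_finite[of h "\<lambda>S. 0" "Y_set ms" "map Gen_Y ms'"]
    by (auto simp: word_op_zero)
  ultimately show ?thesis
    using h by blast
qed

text \<open>In a vanishing combination, an index of minimal rank among those with nonzero coefficient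
  is singled out by its functional.\<close>

lemma (in vector_space) independent_triangular:
  fixes b :: "'i \<Rightarrow> 'b" and \<phi> :: "'i \<Rightarrow> 'b \<Rightarrow> 'a" and rank :: "'i \<Rightarrow> nat"
  assumes add: "\<And>i x y. \<phi> i (x + y) = \<phi> i x + \<phi> i y"
    and scale: "\<And>i c x. \<phi> i (scale c x) = c * \<phi> i x"
    and diag: "\<And>i. i \<in> I \<Longrightarrow> \<phi> i (b i) \<noteq> 0"
    and tri: "\<And>i j. i \<in> I \<Longrightarrow> j \<in> I \<Longrightarrow> i \<noteq> j \<Longrightarrow> rank i \<le> rank j \<Longrightarrow> \<phi> i (b j) = 0"
  shows "inj_on b I \<and> independent (b ` I)"
proof
  show inj: "inj_on b I"
  proof (rule inj_onI, rule ccontr)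
    fix i j assume "i \<in> I" "j \<in> I" "b i = b j" "i \<noteq> j"
    \<comment> \<open>The functional of whichever index has the smaller rank kills the other vector
      but not its own.\<close>
    then show False
      using diag[of i] diag[of j] tri[of i j] tri[of j i] by (metis linear)
  qed
  show "independent (b ` I)"
  proof
    assume "dependent (b ` I)"
    then obtain t u where t: "finite t" "t \<subseteq> b ` I" "(\<Sum>v\<in>t. scale (u v) v) = 0"
      and nz: "\<exists>v\<in>t. u v \<noteq> 0"
      unfolding dependent_explicit by blast
    obtain J where J: "J \<subseteq> I" "finite J" "t = b ` J"
      using finite_subset_image[OF t(1,2)] by blast
    have "\<exists>i. i \<in> J \<and> u (b i) \<noteq> 0"
      using nz J(3) by blast
    then obtain i where i: "i \<in> J" "u (b i) \<noteq> 0"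
      and min: "\<And>j. j \<in> J \<Longrightarrow> u (b j) \<noteq> 0 \<Longrightarrow> rank i \<le> rank j"
      using ex_has_least_nat[of "\<lambda>i. i \<in> J \<and> u (b i) \<noteq> 0" _ rank] by blast
    interpret additive "\<phi> i"
      by unfold_locales (rule add)
    have "inj_on b J"
      using inj J(1) by (rule inj_on_subset)
    then have "0 = \<phi> i (\<Sum>j\<in>J. scale (u (b j)) (b j))"
      using t(3) by (simp add: J(3) sum.reindex zero)
    also have "\<dots> = (\<Sum>j\<in>J. u (b j) * \<phi> i (b j))"
      by (simp add: sum scale)
    also have "\<dots> = (\<Sum>j\<in>{i}. u (b j) * \<phi> i (b j))"
    proof (rule sum.mono_neutral_right)
      show "\<forall>j\<in>J - {i}. u (b j) * \<phi> i (b j) = 0"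
        using J(1) i(1) min tri by (metis DiffE insertI1 mult_zero_left mult_zero_right subsetD)
    qed (use J i(1) in auto)
    finally show False
      using i diag J(1) by auto
  qed
qed

theorem proposition3p2:
  shows "inj_on Y_monomial {(ms, ns). chain_cond ms \<and> chain_cond ns}
    \<and> alg.independent (Y_monomial ` {(ms, ns). chain_cond ms \<and> chain_cond ns})
    \<and> alg.span (Y_monomial ` {(ms, ns). chain_cond ms \<and> chain_cond ns}) = UNIV"
proof -
  let ?\<phi> = "\<lambda>(ms, ns). matrix_coeff (Y_set ms) (uminus ` shifted_set 0 ns)"
  have "inj_on Y_monomial {(ms, ns). chain_cond ms \<and> chain_cond ns}
    \<and> alg.independent (Y_monomial ` {(ms, ns). chain_cond ms \<and> chain_cond ns})"
  proof (rule alg.independent_triangular[where \<phi> = ?\<phi> and rank = "\<lambda>(ms, ns). length ns"])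
    fix i j
    assume "i \<in> {(ms, ns). chain_cond ms \<and> chain_cond ns}"
      "j \<in> {(ms, ns). chain_cond ms \<and> chain_cond ns}" "i \<noteq> j"
      "(\<lambda>(ms, ns). length ns) i \<le> (\<lambda>(ms, ns). length ns) j"
    then show "?\<phi> i (Y_monomial j) = 0"
      using matrix_coeff_other[of "fst i" "snd i" "fst j" "snd j"]
      by (cases i, cases j) fastforce
  qed (auto simp: matrix_coeff_add matrix_coeff_scale matrix_coeff_self)
  then show ?thesis
    using span_chain_monomials by blast
qed

end
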